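(* Let $G=[p_1,\dots,p_{n-1}]$ be a string Coxeter group with every $p_j\in\{3,\infty\}$, realized by the basic system $b_0,\dots,b_{n-1}$ with $b_i\cdot b_i=1$, $b_{j-1}\cdot b_j=-1/2$ if $p_j=3$, $b_{j-1}\cdot b_j=-1$ if $p_j=\infty$, and $b_i\cdot b_j=0$ for $|i-j|\ge2$. Suppose $G$ has a string subgroup of the form $[\dots,\infty,3^k,\infty,\dots]$ with $k\ge1$, i.e. there is $i$ with $p_i=\infty$, $p_{i+1}=\dots=p_{i+k}=3$ and $p_{i+k+1}=\infty$. Let $p\ge5$ be prime. Then $G^p$ is not a string C-group, except possibly when $p=5$ or $p=7$ and $k\le1$ for all such occurrences $[\dots,\infty,3^k,\infty,\dots]$ in $G$.
   Context: $G$ is represented on $\mathbb{R}^n$ by the reflections $r_i(x)=x-2(x\cdot b_i)b_i$, where $p_j$ is the order of $r_{j-1}r_j$. $G^p\le GL_n(\mathbb{Z}_p)$ is the group generated by the reductions mod $p$ of the $r_i$ (still denoted $r_i$). $G^p$ is a string C-group if $\langle r_i:i\in I\rangle\cap\langle r_i:i\in J\rangle=\langle r_i:i\in I\cap J\rangle$ for all $I,J\subseteq\{0,\dots,n-1\}$. *)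

theory Defs
  imports
    "HOL-Library.Extended_Nat"
    "HOL-Algebra.Generated_Groups"
    "Jordan_Normal_Form.Matrix"
    "Berlekamp_Zassenhaus.Finite_Field"
begin

text \<open>
  A string Coxeter group of rank \<open>n\<close> is given by its Schlaefli symbol \<open>[m 1, ..., m (n - 1)]\<close>,
  a function \<open>m :: nat \<Rightarrow> enat\<close> that is only read on \<open>{1..<n}\<close>; the nodes are \<open>0, ..., n - 1\<close>
  and \<open>m j\<close> labels the branch joining the nodes \<open>j - 1\<close> and \<open>j\<close>.
\<close>

definition string_symbol :: "nat \<Rightarrow> (nat \<Rightarrow> enat) \<Rightarrow> bool" where
  "string_symbol n m \<longleftrightarrow> (\<forall>j\<in>{1..<n}. m j = 3 \<or> m j = \<infinity>)"

text \<open>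
  \<open>gram m i j\<close> is the product of the vectors \<open>b i\<close> and \<open>b j\<close> of the basic system.  A branch label
  outside \<open>{3, \<infinity>}\<close> is excluded by \<^const>\<open>string_symbol\<close>; its value \<open>0\<close> is a dummy.
\<close>

definition branch :: "enat \<Rightarrow> real" where
  "branch e = (if e = 3 then - 1 / 2 else if e = \<infinity> then - 1 else 0)"

definition gram :: "(nat \<Rightarrow> enat) \<Rightarrow> nat \<Rightarrow> nat \<Rightarrow> real" where
  "gram m i j =
     (if i = j then 1
      else if j = Suc i then branch (m j)
      else if i = Suc j then branch (m i)
      else 0)"

text \<open>
  The basic system is a basis of \<open>\<real>\<^sup>n\<close>; vectors are written in coordinates with respect to it, so
  that \<open>b i\<close> becomes the unit vector \<open>i\<close>, and the (possibly indefinite or degenerate) symmetric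
  form is the one with the prescribed Gram matrix.
\<close>

definition form :: "nat \<Rightarrow> (nat \<Rightarrow> enat) \<Rightarrow> real vec \<Rightarrow> real vec \<Rightarrow> real" where
  "form n m x y = (\<Sum>i<n. \<Sum>j<n. x $ i * gram m i j * y $ j)"

definition reflection :: "nat \<Rightarrow> (nat \<Rightarrow> enat) \<Rightarrow> nat \<Rightarrow> real vec \<Rightarrow> real vec" where
  "reflection n m i x = x - (2 * form n m x (unit_vec n i)) \<cdot>\<^sub>v unit_vec n i"

definition refl_mat :: "nat \<Rightarrow> (nat \<Rightarrow> enat) \<Rightarrow> nat \<Rightarrow> real mat" where
  "refl_mat n m i = mat n n (\<lambda>(k, j). reflection n m i (unit_vec n j) $ k)"

lemma form_unit_vec:
  assumes "i < n" "j < n"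
  shows "form n m (unit_vec n i) (unit_vec n j) = gram m i j"
proof -
  have "form n m (unit_vec n i) (unit_vec n j)
      = (\<Sum>a<n. \<Sum>b<n. if b = j then if a = i then gram m a b else 0 else 0)"
    unfolding form_def using assms by (intro sum.cong refl) auto
  then show ?thesis using assms by simp
qed

lemma refl_mat_mult_vec:
  assumes "x \<in> carrier_vec n" "i < n"
  shows "refl_mat n m i *\<^sub>v x = reflection n m i x"
proof (rule eq_vecI)
  fix k assume "k < dim_vec (reflection n m i x)"
  then have k: "k < n" by (simp add: reflection_def)
  have x: "dim_vec x = n" using assms by simp
  define u where "u = (unit_vec n i :: real vec) $ k"
  have F: "form n m x (unit_vec n i) = (\<Sum>j<n. gram m j i * x $ j)"
  proof -
    have "form n m x (unit_vec n i)
        = (\<Sum>a<n. \<Sum>b<n. if b = i then gram m a b * x $ a else 0)"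
      unfolding form_def using assms by (intro sum.cong refl) auto
    then show ?thesis using assms by simp
  qed
  have "(refl_mat n m i *\<^sub>v x) $ k
      = (\<Sum>j<n. (unit_vec n j $ k - 2 * gram m j i * u) * x $ j)"
    using k x assms
    by (simp add: refl_mat_def scalar_prod_def reflection_def form_unit_vec u_def lessThan_atLeast0)
  also have "\<dots> = (\<Sum>j<n. unit_vec n j $ k * x $ j - 2 * u * (gram m j i * x $ j))"
    by (intro sum.cong refl) (simp add: algebra_simps)
  also have "\<dots> = (\<Sum>j<n. unit_vec n j $ k * x $ j) - 2 * u * (\<Sum>j<n. gram m j i * x $ j)"
    unfolding sum_subtractf sum_distrib_left ..
  also have "(\<Sum>j<n. unit_vec n j $ k * x $ j) = (\<Sum>j<n. if j = k then x $ j else 0)"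
    using k by (intro sum.cong) auto
  also have "\<dots> = x $ k" using k by simp
  finally show "(refl_mat n m i *\<^sub>v x) $ k = reflection n m i x $ k"
    using k x by (simp add: reflection_def F u_def)
qed (simp add: refl_mat_def reflection_def)

text \<open>Reduction modulo \<open>p = CARD('p)\<close>; only meaningful on matrices with integer entries.\<close>

definition reduce_mat :: "real mat \<Rightarrow> 'p::prime_card mod_ring mat" where
  "reduce_mat A = map_mat (\<lambda>x. of_int \<lfloor>x\<rfloor>) A"

lemma refl_mat_Ints:
  assumes "string_symbol n m" "i < n" "k < n" "j < n"
  shows "refl_mat n m i $$ (k, j) \<in> \<int>"
proof -
  have "2 * gram m j i \<in> {0, 1, -1, 2, -2}"
    using assms by (auto simp: gram_def branch_def)
  then have "2 * gram m j i \<in> \<int>" by auto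
  then show ?thesis
    using assms by (simp add: refl_mat_def reflection_def form_unit_vec)
qed

definition GL :: "nat \<Rightarrow> 'a::field mat monoid" where
  "GL n = units_of (ring_mat TYPE('a) n ())"

definition red_refl :: "nat \<Rightarrow> (nat \<Rightarrow> enat) \<Rightarrow> nat \<Rightarrow> 'p::prime_card mod_ring mat" where
  "red_refl n m i = reduce_mat (refl_mat n m i)"

definition red_group :: "nat \<Rightarrow> (nat \<Rightarrow> enat) \<Rightarrow> 'p::prime_card mod_ring mat monoid" where
  "red_group n m = (GL n)\<lparr>carrier := generate (GL n) (red_refl n m ` {..<n})\<rparr>"

definition string_C_group :: "('g, 'h) monoid_scheme \<Rightarrow> nat \<Rightarrow> (nat \<Rightarrow> 'g) \<Rightarrow> bool" where
  "string_C_group H n r \<longleftrightarrow>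
     (\<forall>I J. I \<subseteq> {..<n} \<longrightarrow> J \<subseteq> {..<n} \<longrightarrow>
        generate H (r ` I) \<inter> generate H (r ` J) = generate H (r ` (I \<inter> J)))"

text \<open>\<open>[..., \<infinity>, 3\<^sup>k, \<infinity>, ...]\<close> occurs, the first displayed \<open>\<infinity>\<close> being \<open>m i\<close>.\<close>

definition occurs_inf_3k_inf :: "nat \<Rightarrow> (nat \<Rightarrow> enat) \<Rightarrow> nat \<Rightarrow> nat \<Rightarrow> bool" where
  "occurs_inf_3k_inf n m i k \<longleftrightarrow>
     1 \<le> k \<and> 1 \<le> i \<and> i + k + 1 \<le> n - 1 \<and>
     m i = \<infinity> \<and> (\<forall>j\<in>{i + 1..i + k}. m j = 3) \<and> m (i + k + 1) = \<infinity>"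

end

theory Submission
  imports Defs
begin

text \<open>
  Let \<open>K\<close> be the \<open>k + 1\<close> nodes of the part \<open>3\<^sup>k\<close> of an occurrence \<open>[..., \<infinity>, 3\<^sup>k, \<infinity>, ...]\<close>, and
  let \<open>I\<close> and \<open>J\<close> be \<open>K\<close> together with the node on its left and on its right.  The subgroup of \<open>K\<close>
  is a symmetric group, but mod \<open>p\<close> the groups of \<open>I\<close> and \<open>J\<close> both contain the reflection in a
  vector \<open>v\<close> spanned by the roots of \<open>K\<close> that is not a root of \<open>K\<close>.  The vectors whose
  reflections lie in a given group are closed under each other's reflections, and \<open>v\<close> is
  produced from the left node and at most three nodes of \<open>K\<close> in this way: \<open>v\<close> is
  \<open>(8 b\<^sub>1 + 5 b\<^sub>2) / 7\<close> if \<open>p\<close> is not \<open>5\<close> or \<open>7\<close>, and a vector of the span of \<open>b\<^sub>1, b\<^sub>2, b\<^sub>3\<close> if it is.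
  The symmetric group moves the right node to a vector that has the same
  products with the roots of \<open>K\<close> as the left node, so \<open>v\<close> is produced for \<open>J\<close>, too.
\<close>

section \<open>Symmetric forms and sets of vectors closed under reflections\<close>

locale sym_form =
  fixes n :: nat and g :: "nat \<Rightarrow> nat \<Rightarrow> 'a::field"
  assumes sym: "g s t = g t s"
begin

definition pair :: "(nat \<Rightarrow> 'a) \<Rightarrow> (nat \<Rightarrow> 'a) \<Rightarrow> 'a" where
  "pair x y = (\<Sum>s<n. \<Sum>t<n. x s * g s t * y t)"

lemma pair_add_left: "pair (\<lambda>t. x t + y t) z = pair x z + pair y z"
  by (simp add: pair_def algebra_simps sum.distrib)

lemma pair_add_right: "pair z (\<lambda>t. x t + y t) = pair z x + pair z y"
  by (simp add: pair_def algebra_simps sum.distrib)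

lemma pair_diff_left: "pair (\<lambda>t. x t - y t) z = pair x z - pair y z"
  by (simp add: pair_def algebra_simps sum_subtractf)

lemma pair_diff_right: "pair z (\<lambda>t. x t - y t) = pair z x - pair z y"
  by (simp add: pair_def algebra_simps sum_subtractf)

lemma pair_minus_left: "pair (\<lambda>t. - x t) z = - pair x z"
  by (simp add: pair_def sum_negf)

lemma pair_minus_right: "pair z (\<lambda>t. - x t) = - pair z x"
  by (simp add: pair_def sum_negf)

lemma pair_scale_left: "pair (\<lambda>t. c * x t) z = c * pair x z"
  by (simp add: pair_def sum_distrib_left mult.assoc)

lemma pair_scale_right: "pair z (\<lambda>t. c * x t) = c * pair z x"
  by (simp add: pair_def sum_distrib_left mult_ac)

lemmas pair_linear = pair_add_left pair_add_right pair_diff_left pair_diff_right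
  pair_minus_left pair_minus_right pair_scale_left pair_scale_right

lemma pair_commute: "pair x y = pair y x"
proof -
  have "pair x y = (\<Sum>t<n. \<Sum>s<n. x s * g s t * y t)"
    unfolding pair_def by (rule sum.swap)
  then show ?thesis by (simp add: pair_def sym[of _ "_ :: nat"] mult_ac)
qed

definition basis :: "nat \<Rightarrow> nat \<Rightarrow> 'a" where
  "basis s t = of_bool (t = s)"

lemma pair_basis_right: "t < n \<Longrightarrow> pair x (basis t) = (\<Sum>s<n. x s * g s t)"
  by (simp add: pair_def basis_def of_bool_def if_distrib cong: if_cong)

lemma pair_basis: "s < n \<Longrightarrow> t < n \<Longrightarrow> pair (basis s) (basis t) = g s t"
  by (simp add: pair_basis_right basis_def of_bool_def if_distrib[of "\<lambda>c. c * _"] cong: if_cong)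

text \<open>The norm is 2 because \<open>g\<close> will be twice the Gram matrix, so reflections
  need no halves. Stated for arbitrary sets, so that one computation serves the groups of both
  \<open>I\<close> and \<open>J\<close>.\<close>

definition refl_closed :: "(nat \<Rightarrow> 'a) set \<Rightarrow> bool" where
  "refl_closed R \<longleftrightarrow> (\<forall>x\<in>R. pair x x = 2) \<and> (\<forall>x\<in>R. \<forall>y\<in>R. (\<lambda>t. y t - pair x y * x t) \<in> R)"

lemma refl_closed_norm: "refl_closed R \<Longrightarrow> x \<in> R \<Longrightarrow> pair x x = 2"
  by (simp add: refl_closed_def)

lemma refl_closedD:
  assumes "refl_closed R" "x \<in> R" "y \<in> R" "pair x y = c" "\<And>t. z t = y t - c * x t"
  shows "z \<in> R"
proof -
  have "z = (\<lambda>t. y t - pair x y * x t)" unfolding assms(4) using assms(5) by auto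
  with assms(1-3) show ?thesis unfolding refl_closed_def by blast
qed

lemma refl_closed_minus:
  assumes "refl_closed R" "x \<in> R"
  shows "(\<lambda>t. - x t) \<in> R"
  by (rule refl_closedD[OF assms(1) assms(2) assms(2) refl_closed_norm[OF assms]]) simp

text \<open>The sum \<open>x + y\<close> is orthogonal to \<open>x\<close> and \<open>y\<close>, so
  reflecting in \<open>y\<close> and then in \<open>x\<close> adds \<open>2 * (x + y)\<close> to
  each vector of the family.\<close>

lemma refl_closed_translate:
  assumes R: "refl_closed R" "x \<in> R" "y \<in> R" and xy: "pair x y = - 2"
  shows "(\<lambda>t. x t + 2 * of_nat N * (x t + y t)) \<in> R"
proof (induction N)
  case 0
  then show ?case using R by simp
next
  case (Suc N)
  have xx: "pair x x = 2" "pair y y = 2" "pair y x = - 2"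
    using R xy by (auto simp: refl_closed_norm pair_commute)
  let ?z = "\<lambda>t. x t + 2 * of_nat N * (x t + y t)"
  have "(\<lambda>t. ?z t + 2 * y t) \<in> R"
    by (rule refl_closedD[OF R(1) R(3) Suc, of "-2"]) (simp_all add: pair_linear xx)
  moreover have "pair x (\<lambda>t. ?z t + 2 * y t) = - 2"
    unfolding pair_linear xx xy by simp
  ultimately show ?case
    by (rule refl_closedD[OF R(1) R(2)]) (simp add: algebra_simps)
qed

section \<open>New vectors from an end node and two or three nodes of a string\<close>

text \<open>
  The new root is the reflection of \<open>(u1 + u2) - 2/7 (u0 + u1 + u2)\<close> in \<open>u1 + 2 (u0 + u1)\<close>.  More
  generally, for \<open>c = s (1 - s) / (1 + s + s\<^sup>2)\<close> the reflection of \<open>(u1 + u2) + c (u0 + u1 + u2)\<close>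
  in \<open>u1 + s (u0 + u1)\<close> has no component along \<open>u0\<close>.
\<close>

lemma new_root_rank3:
  fixes u0 u1 u2 :: "nat \<Rightarrow> 'a"
  assumes R: "refl_closed R" "u0 \<in> R" "u1 \<in> R" "u2 \<in> R"
    and p01: "pair u0 u1 = - 2" and p02: "pair u0 u2 = 0" and p12: "pair u1 u2 = - 1"
    and N: "7 * of_nat N = (- 1 :: 'a)"
  shows "(\<lambda>t. 8 / 7 * u1 t + 5 / 7 * u2 t) \<in> R"
proof -
  have nz: "(7::'a) \<noteq> 0" using N by auto
  have q: "pair u0 u0 = 2" "pair u1 u1 = 2" "pair u2 u2 = 2"
    "pair u1 u0 = - 2" "pair u2 u0 = 0" "pair u2 u1 = - 1"
    using R p01 p02 p12 by (auto simp: refl_closed_norm pair_commute)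
  note gr = p01 p02 p12 q
  have y: "(\<lambda>t. u1 t + 2 * (u1 t + u0 t)) \<in> R"
    using refl_closed_translate[OF R(1) R(3) R(2) q(4), of 1] by simp
  have w: "(\<lambda>t. u1 t + u2 t) \<in> R"
    by (rule refl_closedD[OF R(1) R(4) R(3) q(6)]) simp
  have "(\<lambda>t. (u1 t + u2 t) + 2 * of_nat N * ((u1 t + u2 t) + u0 t)) \<in> R"
    by (rule refl_closed_translate[OF R(1) w R(2)]) (simp add: pair_linear gr)
  moreover have "of_nat N = (- 1 / 7 :: 'a)"
    using N nz by (metis nonzero_mult_div_cancel_left)
  ultimately have y': "(\<lambda>t. (u1 t + u2 t) + 2 * (- 1 / 7) * ((u1 t + u2 t) + u0 t)) \<in> R"
    by simp
  \<comment> \<open>In coordinates along \<open>u0, u1, u2\<close> the mirror vector is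
    \<open>(2, 3, 0)\<close> and the reflected one \<open>(- 2/7, 5/7, 5/7)\<close>; adding 1/7 of
    the former to the latter cancels \<open>u0\<close>.\<close>
  show ?thesis
  proof (rule refl_closedD[OF R(1) y y', of "- 1 / 7"])
    show "pair (\<lambda>t. u1 t + 2 * (u1 t + u0 t))
      (\<lambda>t. (u1 t + u2 t) + 2 * (- 1 / 7) * ((u1 t + u2 t) + u0 t)) = - 1 / 7"
      unfolding pair_linear gr using nz by (simp add: field_simps)
  qed (use nz in \<open>simp add: field_simps\<close>)
qed

text \<open>
  The two vectors below are found by a search: their first coordinates vanish mod \<open>5\<close> and mod \<open>7\<close>,
  respectively, while the remaining ones, \<open>(1, 2, 4)\<close> and \<open>(4, 5, 2)\<close>, are not those of a root of
  \<open>A\<^sub>3\<close>.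
\<close>

definition lin4 :: "(nat \<Rightarrow> nat \<Rightarrow> 'a) \<Rightarrow> int \<Rightarrow> int \<Rightarrow> int \<Rightarrow> int \<Rightarrow> nat \<Rightarrow> 'a" where
  "lin4 u c0 c1 c2 c3 t = of_int c0 * u 0 t + of_int c1 * u 1 t + of_int c2 * u 2 t + of_int c3 * u 3 t"

lemma new_roots_rank4:
  fixes u :: "nat \<Rightarrow> nat \<Rightarrow> 'a"
  assumes R: "refl_closed R" "u 0 \<in> R" "u 1 \<in> R" "u 2 \<in> R" "u 3 \<in> R"
    and p: "pair (u 0) (u 1) = - 2" "pair (u 0) (u 2) = 0" "pair (u 0) (u 3) = 0"
      "pair (u 1) (u 2) = - 1" "pair (u 1) (u 3) = 0" "pair (u 2) (u 3) = - 1"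
  shows "lin4 u 140 96 27 24 \<in> R" "lin4 u 98 67 19 16 \<in> R"
proof -
  have q: "pair (u 0) (u 0) = 2" "pair (u 1) (u 1) = 2" "pair (u 2) (u 2) = 2" "pair (u 3) (u 3) = 2"
    "pair (u 1) (u 0) = - 2" "pair (u 2) (u 0) = 0" "pair (u 3) (u 0) = 0"
    "pair (u 2) (u 1) = - 1" "pair (u 3) (u 1) = 0" "pair (u 3) (u 2) = - 1"
    using R p by (auto simp: refl_closed_norm pair_commute)
  have lin: "lin4 u c0 c1 c2 c3
    = (\<lambda>t. of_int c0 * u 0 t + of_int c1 * u 1 t + of_int c2 * u 2 t + of_int c3 * u 3 t)"
    for c0 c1 c2 c3 by (auto simp: lin4_def)
  \<comment> \<open>With integer coefficients each reflection below is plain integer arithmetic,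
    valid in any field.\<close>
  have pl: "pair (lin4 u c0 c1 c2 c3) (lin4 u d0 d1 d2 d3) = of_int
     (c0 * (2 * d0 - 2 * d1) + c1 * (2 * d1 - 2 * d0 - d2) + c2 * (2 * d2 - d1 - d3)
      + c3 * (2 * d3 - d2))" for c0 c1 c2 c3 d0 d1 d2 d3
    unfolding lin pair_linear p q by (simp add: algebra_simps)
  have st: "lin4 u e0 e1 e2 e3 \<in> R"
    if "lin4 u c0 c1 c2 c3 \<in> R" "lin4 u d0 d1 d2 d3 \<in> R"
      "k = c0 * (2 * d0 - 2 * d1) + c1 * (2 * d1 - 2 * d0 - d2) + c2 * (2 * d2 - d1 - d3)
      + c3 * (2 * d3 - d2)"
      "e0 = d0 - k * c0" "e1 = d1 - k * c1" "e2 = d2 - k * c2" "e3 = d3 - k * c3"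
    for c0 c1 c2 c3 d0 d1 d2 d3 e0 e1 e2 e3 k
  proof (rule refl_closedD[OF R(1) that(1,2), of "of_int k"])
    show "pair (lin4 u c0 c1 c2 c3) (lin4 u d0 d1 d2 d3) = of_int k"
      unfolding that(3) by (rule pl)
  qed (simp add: lin4_def that(4-) algebra_simps)
  have u: "lin4 u 1 0 0 0 \<in> R" "lin4 u 0 1 0 0 \<in> R" "lin4 u 0 0 1 0 \<in> R" "lin4 u 0 0 0 1 \<in> R"
    using R by (simp_all add: lin)
  \<comment> \<open>Reflections in single \<open>u i\<close> build \<open>x = (6, 4, 1, 1)\<close>
    and the vectors \<open>(2, 4, 4, 1)\<close> and \<open>(2, 3, 3, 0)\<close>; reflecting these
    two in \<open>x\<close> gives the claims.\<close>
  have "lin4 u 0 0 1 1 \<in> R" by (rule st[OF u(3) u(4) refl]) simp_all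
  then have "lin4 u 0 1 1 1 \<in> R" by (rule st[OF u(2) _ refl]) simp_all
  then have "lin4 u 2 1 1 1 \<in> R" by (rule st[OF u(1) _ refl]) simp_all
  then have a: "lin4 u 2 4 1 1 \<in> R" by (rule st[OF u(2) _ refl]) simp_all
  then have x: "lin4 u 6 4 1 1 \<in> R" by (rule st[OF u(1) _ refl]) simp_all
  from a have "lin4 u 2 4 4 1 \<in> R" by (rule st[OF u(3) _ refl]) simp_all
  then show "lin4 u 140 96 27 24 \<in> R" by (rule st[OF x _ refl]) simp_all
  have "lin4 u 2 1 0 0 \<in> R" by (rule st[OF u(1) u(2) refl]) simp_all
  then have "lin4 u 2 3 0 0 \<in> R" by (rule st[OF u(2) _ refl]) simp_all
  then have "lin4 u 2 3 3 0 \<in> R" by (rule st[OF u(3) _ refl]) simp_all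
  then show "lin4 u 98 67 19 16 \<in> R" by (rule st[OF x _ refl]) simp_all
qed

section \<open>Reflection matrices and their products\<close>

definition refl_matrix :: "(nat \<Rightarrow> 'a) \<Rightarrow> 'a mat" where
  "refl_matrix x = mat n n (\<lambda>(a, b). of_bool (a = b) - x a * pair x (basis b))"

lemma refl_matrix_carrier [simp]: "refl_matrix x \<in> carrier_mat n n"
  by (simp add: refl_matrix_def)

lemma pair_expand: "pair x y = (\<Sum>b<n. pair x (basis b) * y b)"
proof -
  have "pair x y = (\<Sum>b<n. \<Sum>s<n. x s * g s b * y b)"
    unfolding pair_def by (rule sum.swap)
  then show ?thesis by (simp add: pair_basis_right sum_distrib_right)
qed

lemma refl_matrix_mult:
  "refl_matrix x * refl_matrix y = mat n n (\<lambda>(a, b). of_bool (a = b) - x a * pair x (basis b)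
     - y a * pair y (basis b) + x a * pair x y * pair y (basis b))"
proof (rule eq_matI, goal_cases)
  case (1 a b)
  then have ab: "a < n" "b < n" by auto
  have "(refl_matrix x * refl_matrix y) $$ (a, b)
    = (\<Sum>c<n. (of_bool (a = c) - x a * pair x (basis c)) * (of_bool (c = b) - y c * pair y (basis b)))"
    using ab by (simp add: refl_matrix_def scalar_prod_def lessThan_atLeast0)
  \<comment> \<open>Once the Kronecker deltas are split off, the remaining sum over \<open>c\<close>
    is a pairing by \<open>pair_expand\<close>.\<close>
  also have "\<dots> = (\<Sum>c<n. (if c = a then of_bool (c = b) - y c * pair y (basis b) else 0)
      - (if c = b then x a * pair x (basis c) else 0)
      + x a * (pair x (basis c) * y c) * pair y (basis b))"
    by (intro sum.cong refl) (auto simp: algebra_simps)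
  also have "\<dots> = of_bool (a = b) - y a * pair y (basis b) - x a * pair x (basis b)
      + x a * pair x y * pair y (basis b)"
    unfolding sum.distrib sum_subtractf pair_expand[of x y] using ab
    by (simp add: sum_distrib_left sum_distrib_right)
  finally show ?case using ab by simp
qed (simp_all add: refl_matrix_def)

lemma refl_matrix_invol: "pair x x = 2 \<Longrightarrow> refl_matrix x * refl_matrix x = 1\<^sub>m n"
  unfolding refl_matrix_mult by (rule eq_matI) (auto simp: algebra_simps)

text \<open>The reflection in \<open>x\<close> preserves the form, so conjugation by it carries the
  reflection in \<open>y\<close> to that in the image of \<open>y\<close>. This makes root sets
  closed under reflections.\<close>

lemma refl_matrix_conj:
  assumes "pair x x = 2"
  shows "refl_matrix x * refl_matrix y * refl_matrix x
    = refl_matrix (\<lambda>t. y t - pair x y * x t)"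
proof (rule eq_matI, goal_cases)
  case (1 a b)
  then have ab: "a < n" "b < n" by (auto simp: refl_matrix_def)
  have "(refl_matrix x * refl_matrix y * refl_matrix x) $$ (a, b)
    = (\<Sum>c<n. (of_bool (a = c) - x a * pair x (basis c)
     - y a * pair y (basis c) + x a * pair x y * pair y (basis c)) *
      (of_bool (c = b) - x c * pair x (basis b)))"
    unfolding refl_matrix_mult using ab
    by (simp add: refl_matrix_def scalar_prod_def lessThan_atLeast0)
  also have "\<dots> = (\<Sum>c<n. (if c = a then of_bool (c = b) - x c * pair x (basis b) else 0)
      + (if c = b then - x a * pair x (basis c)
     - y a * pair y (basis c) + x a * pair x y * pair y (basis c) else 0)
      + ((x a * (pair x (basis c) * x c)
         + y a * (pair y (basis c) * x c) - x a * pair x y * (pair y (basis c) * x c)) * pair x (basis b)))"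
    by (intro sum.cong refl) (auto simp: algebra_simps)
  also have "\<dots> = of_bool (a = b) - x a * pair x (basis b) + (- x a * pair x (basis b)
     - y a * pair y (basis b) + x a * pair x y * pair y (basis b))
     + (x a * pair x x + y a * pair y x - x a * pair x y * pair y x) * pair x (basis b)"
    unfolding sum.distrib pair_expand[of x x] pair_expand[of y x] using ab
    by (simp add: sum_distrib_left sum_distrib_right sum.distrib sum_subtractf algebra_simps)
  also have "\<dots> = refl_matrix (\<lambda>t. y t - pair x y * x t) $$ (a, b)"
    unfolding refl_matrix_def pair_linear assms pair_commute[of y x]
    using ab by (simp add: algebra_simps)
  finally show ?case .
qed (simp_all add: refl_matrix_def)

end

text \<open>Doubling the Gram matrix leaves only the values 2, -1, -2 and 0, so the floor is
  exact.\<close>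

definition red_gram :: "(nat \<Rightarrow> enat) \<Rightarrow> nat \<Rightarrow> nat \<Rightarrow> 'p::prime_card mod_ring" where
  "red_gram m s t = of_int \<lfloor>2 * gram m s t\<rfloor>"

section \<open>The group mod \<open>p\<close> and its generating reflections\<close>

locale string_mod =
  fixes n :: nat and m :: "nat \<Rightarrow> enat" and P :: "'p::prime_card itself"
  assumes string: "string_symbol n m"
begin

sublocale sym_form n "red_gram m :: nat \<Rightarrow> nat \<Rightarrow> 'p mod_ring"
  by unfold_locales (auto simp: red_gram_def gram_def)

abbreviation r :: "nat \<Rightarrow> 'p mod_ring mat" where "r \<equiv> red_refl n m"

abbreviation H :: "'p mod_ring mat monoid" where "H \<equiv> red_group n m"

lemma red_gram_simps:
  "red_gram m s s = (2 :: 'p mod_ring)"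
  "m (Suc s) = \<infinity> \<Longrightarrow> red_gram m s (Suc s) = (- 2 :: 'p mod_ring)"
  "m (Suc s) = 3 \<Longrightarrow> red_gram m s (Suc s) = (- 1 :: 'p mod_ring)"
  "m (Suc s) = \<infinity> \<Longrightarrow> red_gram m (Suc s) s = (- 2 :: 'p mod_ring)"
  "m (Suc s) = 3 \<Longrightarrow> red_gram m (Suc s) s = (- 1 :: 'p mod_ring)"
  "s \<noteq> t \<Longrightarrow> t \<noteq> Suc s \<Longrightarrow> s \<noteq> Suc t \<Longrightarrow> red_gram m s t = (0 :: 'p mod_ring)"
  using floor_of_int[of "- 1", where 'a = real]
  by (simp_all add: red_gram_def gram_def branch_def)

lemma red_refl_eq:
  assumes "t < n"
  shows "r t = refl_matrix (basis t)"
proof (rule eq_matI, goal_cases)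
  case (1 a b)
  then have ab: "a < n" "b < n" by (auto simp: refl_matrix_def)
  have gi: "2 * gram m b t \<in> \<int>"
  proof -
    have "2 * gram m b t \<in> {0, 1, -1, 2, -2}"
      using string assms ab by (auto simp: string_symbol_def gram_def branch_def)
    then show ?thesis by auto
  qed
  then obtain z where z: "2 * gram m b t = of_int z" by (auto elim: Ints_cases)
  have "refl_mat n m t $$ (a, b) = of_bool (a = b) - of_int z * of_bool (a = t)"
    using ab assms z by (simp add: refl_mat_def reflection_def form_unit_vec)
  also have "\<dots> = of_int (of_bool (a = b) - z * of_bool (a = t))"
    by simp
  finally have "r t $$ (a, b) = of_int (of_bool (a = b) - z * of_bool (a = t))"
    using ab by (simp only: red_refl_def reduce_mat_def) (simp add: refl_mat_def)
  also have "\<dots> = of_bool (a = b) - of_bool (a = t) * of_int z"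
    by simp
  also have "(of_int z :: 'p mod_ring) = red_gram m t b"
    using z by (simp add: sym[of t b]) (simp add: red_gram_def)
  finally show ?case
    using ab assms by (simp add: refl_matrix_def pair_basis) (simp add: basis_def)
qed (simp_all add: refl_matrix_def red_refl_def reduce_mat_def refl_mat_def)

lemma r_invol: "t < n \<Longrightarrow> r t * r t = 1\<^sub>m n"
  by (simp add: red_refl_eq refl_matrix_invol pair_basis red_gram_simps)

lemma r_carrier: "t < n \<Longrightarrow> r t \<in> carrier_mat n n"
  by (simp add: red_refl_eq)

lemma group_GL: "group (GL n :: 'p mod_ring mat monoid)"
  unfolding GL_def
  by (rule monoid.units_group) (rule semiring.axioms(2)[OF semiring_mat])

lemma r_GL: "r ` {..<n} \<subseteq> carrier (GL n)"
  using r_invol r_carrier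
  by (auto simp: GL_def units_of_carrier Units_def ring_mat_simps)

lemma group_H: "group H"
  unfolding red_group_def
  by (rule subgroup.subgroup_is_group[OF group.generate_is_subgroup[OF group_GL r_GL] group_GL])

lemma mult_H: "x \<otimes>\<^bsub>H\<^esub> y = x * y" and one_H: "\<one>\<^bsub>H\<^esub> = 1\<^sub>m n"
  by (simp_all add: red_group_def GL_def units_of_mult units_of_one ring_mat_simps)

lemma inv_H_r: "t < n \<Longrightarrow> inv\<^bsub>H\<^esub> (r t) = r t"
  by (rule group.inv_equality[OF group_H])
    (simp_all add: mult_H one_H r_invol, simp_all add: red_group_def generate.incl)

text \<open>The generators are involutions, so no case for inverses is needed.\<close>

lemma generate_H_induct [consumes 2, case_names one incl mult]:
  assumes x: "x \<in> generate H (r ` K)" and K: "K \<subseteq> {..<n}"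
    and one: "Q (1\<^sub>m n)" and r: "\<And>s. s \<in> K \<Longrightarrow> Q (r s)"
    and mult: "\<And>x y. Q x \<Longrightarrow> Q y \<Longrightarrow> Q (x * y)"
  shows "Q x"
  using x
proof (induction rule: generate.induct)
  case (inv h)
  then show ?case using K r inv_H_r by auto
qed (use one r mult in \<open>auto simp: one_H mult_H\<close>)

section \<open>Vectors whose reflections lie in a given subgroup\<close>

definition root_set :: "nat set \<Rightarrow> (nat \<Rightarrow> 'p mod_ring) set" where
  "root_set K = {x. pair x x = 2 \<and> refl_matrix x \<in> generate H (r ` K)}"

lemma root_set_basis: "s \<in> K \<Longrightarrow> s < n \<Longrightarrow> basis s \<in> root_set K"
  by (auto simp: root_set_def pair_basis red_gram_simps red_refl_eq[symmetric] intro: generate.incl)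

lemma refl_closed_root_set: "refl_closed (root_set K)"
proof -
  have "(\<lambda>t. y t - pair x y * x t) \<in> root_set K" if "x \<in> root_set K" "y \<in> root_set K" for x y
  proof -
    have x: "pair x x = 2" "refl_matrix x \<in> generate H (r ` K)"
      and y: "pair y y = 2" "refl_matrix y \<in> generate H (r ` K)"
      using that by (auto simp: root_set_def)
    have "refl_matrix x * refl_matrix y * refl_matrix x \<in> generate H (r ` K)"
      using generate.eng[OF generate.eng[OF x(2) y(2)] x(2)] by (simp add: mult_H)
    moreover have "pair (\<lambda>t. y t - pair x y * x t) (\<lambda>t. y t - pair x y * x t) = 2"
      unfolding pair_linear x y pair_commute[of y x] by (simp add: algebra_simps)
    ultimately show ?thesis by (simp add: root_set_def refl_matrix_conj[OF x(1)])
  qed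
  then show ?thesis by (auto simp: refl_closed_def root_set_def)
qed

section \<open>A fixed occurrence and the vector coming from its right end\<close>

context
  fixes q k :: nat
  assumes occ: "occurs_inf_3k_inf n m (Suc q) k"
begin

text \<open>As \<open>m j\<close> labels the branch from \<open>j - 1\<close> to \<open>j\<close>,
  the left node is \<open>q\<close> and the right node is \<open>Suc (Suc (q + k))\<close>.\<close>

abbreviation K :: "nat set" where "K \<equiv> {Suc q..Suc (q + k)}"

lemma occ_simps:
  "1 \<le> k" "Suc (Suc (q + k)) < n" "m (Suc q) = \<infinity>" "m (Suc (Suc (q + k))) = \<infinity>"
  "\<And>j. Suc q < j \<Longrightarrow> j \<le> Suc (q + k) \<Longrightarrow> m j = 3"
  using occ by (auto simp: occurs_inf_3k_inf_def)

lemma red_gram_K: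
  assumes "s \<in> K" "t \<in> K"
  shows "red_gram m s t
    = (2 * of_bool (s = t) - of_bool (s = Suc t) - of_bool (t = Suc s) :: 'p mod_ring)"
proof -
  consider "s = t" | "t = Suc s" | "s = Suc t" | "s \<noteq> t" "t \<noteq> Suc s" "s \<noteq> Suc t" by blast
  then show ?thesis
  proof cases
    case 2
    then show ?thesis using assms occ_simps(5)[of t] by (simp add: red_gram_simps)
  next
    case 3
    then show ?thesis using assms occ_simps(5)[of s] by (simp add: red_gram_simps)
  qed (simp_all add: red_gram_simps)
qed

text \<open>
  Reflecting the right end node successively in the nodes of \<open>K\<close>, from right to left, yields
  a root that is orthogonal to all of \<open>K\<close> except the leftmost node.
\<close>

lemma transported_end_root:
  fixes f
  defines "f \<equiv> \<lambda>l t. basis (Suc (Suc (q + k))) t + 2 * of_bool (l \<le> t \<and> t \<le> Suc (q + k)) :: 'p mod_ring"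
  assumes "Suc q \<le> l" "l \<le> Suc (Suc (q + k))"
  shows "f l \<in> root_set {Suc q..Suc (Suc (q + k))} \<and>
    (\<forall>b\<in>K. pair (f l) (basis b) = 2 * of_bool (b = l) - 2 * of_bool (Suc b = l))"
  using assms(3,2)
proof (induction rule: inc_induct)
  case base
  have f: "f (Suc (Suc (q + k))) = basis (Suc (Suc (q + k)))"
    by (auto simp: f_def)
  have "pair (basis (Suc (Suc (q + k)))) (basis b) = 2 * of_bool (b = Suc (Suc (q + k)))
    - 2 * of_bool (Suc b = Suc (Suc (q + k)))" if "b \<in> K" for b
    using that occ_simps(2,4)
    by (cases "b = Suc (q + k)") (simp_all add: pair_basis red_gram_simps)
  then show ?case using occ_simps(2) by (simp add: f root_set_basis)
next
  case (step l)
  then have l: "l \<in> K" "l < n" using occ_simps(2) by auto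
  from step have IH: "f (Suc l) \<in> root_set {Suc q..Suc (Suc (q + k))}"
    "\<And>b. b \<in> K \<Longrightarrow> pair (f (Suc l)) (basis b) = 2 * of_bool (b = Suc l) - 2 * of_bool (b = l)"
    by auto
  have f: "f l t = f (Suc l) t - (- 2) * basis l t" for t
    using l by (auto simp: f_def basis_def)
  have "f l \<in> root_set {Suc q..Suc (Suc (q + k))}"
  proof (rule refl_closedD[OF refl_closed_root_set _ IH(1) _ f])
    show "pair (basis l) (f (Suc l)) = - 2"
      using IH(2)[OF l(1)] by (simp add: pair_commute)
  qed (use l in \<open>auto intro: root_set_basis\<close>)
  moreover have "pair (f l) (basis b) = 2 * of_bool (b = l) - 2 * of_bool (Suc b = l)"
    if "b \<in> K" for b
  proof -
    have "f l = (\<lambda>t. f (Suc l) t - (- 2) * basis l t)" using f by auto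
    then have "pair (f l) (basis b) = pair (f (Suc l)) (basis b) - (- 2) * pair (basis l) (basis b)"
      by (simp only: pair_linear)
    also have "\<dots> = 2 * of_bool (b = Suc l) - 2 * of_bool (b = l) + 2 * red_gram m l b"
      using that l occ_simps(2) by (simp add: IH(2) pair_basis)
    finally show ?thesis using that l by (auto simp: red_gram_K)
  qed
  ultimately show ?case by blast
qed

text \<open>At \<open>l = Suc q\<close> the transported root has product 2 with the leftmost node of
  \<open>K\<close>; its negative imitates the left node \<open>q\<close>.\<close>

lemma end_root:
  obtains u where "u \<in> root_set {Suc q..Suc (Suc (q + k))}"
    "\<And>b. b \<in> K \<Longrightarrow> pair u (basis b) = - 2 * of_bool (b = Suc q)"
proof -
  obtain f where f: "f \<in> root_set {Suc q..Suc (Suc (q + k))}"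
    "\<And>b. b \<in> K \<Longrightarrow> pair f (basis b) = 2 * of_bool (b = Suc q) - 2 * of_bool (Suc b = Suc q)"
    using transported_end_root[of "Suc q"] by auto
  show ?thesis
  proof (rule that[OF refl_closed_minus[OF refl_closed_root_set f(1)]])
    show "pair (\<lambda>t. - f t) (basis b) = - 2 * of_bool (b = Suc q)" if "b \<in> K" for b
      using that f(2)[OF that] unfolding pair_linear by auto
  qed
qed

section \<open>The group of \<open>K\<close> as permutations of coordinates\<close>

text \<open>
  On the span of \<open>K\<close>, with \<open>b\<^sub>t\<close> written as a difference \<open>e\<^sub>t\<^sub>-\<^sub>1 - e\<^sub>t\<close>, the functional
  \<open>x \<mapsto> x\<^sub>t\<^sub>+\<^sub>1 - x\<^sub>t\<close> is the coordinate of \<open>e\<^sub>t\<close>, and the symmetric group permutes these.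
  Checking only which roots a reflection maps to roots would not suffice: for \<open>k = 1\<close> and
  \<open>p = 11\<close> or \<open>13\<close> the reflection in \<open>(8 b\<^sub>1 + 5 b\<^sub>2) / 7\<close> permutes the roots of \<open>A\<^sub>2\<close>.
\<close>

definition permutes_coords :: "'p mod_ring mat \<Rightarrow> bool" where
  "permutes_coords x \<longleftrightarrow> x \<in> carrier_mat n n
    \<and> (\<forall>b\<in>K. \<forall>a<n. a \<notin> K \<longrightarrow> x $$ (a, b) = 0)
    \<and> (\<forall>t\<in>{q..Suc (q + k)}. \<exists>u\<in>{q..Suc (q + k)}. \<forall>b\<in>K.
         x $$ (Suc t, b) - x $$ (t, b) = of_bool (Suc u = b) - of_bool (u = b))"

lemma permutes_coords_r:
  assumes s: "s \<in> K"
  shows "permutes_coords (r s)"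
proof -
  have sn: "s < n" using s occ_simps(2) by auto
  have e: "r s $$ (a, b) = of_bool (a = b) - of_bool (a = s) * red_gram m s b"
    if "a < n" "b < n" for a b
    using that sn by (simp add: red_refl_eq refl_matrix_def pair_basis) (simp add: basis_def)
  have "\<exists>u\<in>{q..Suc (q + k)}. \<forall>b\<in>K.
         r s $$ (Suc t, b) - r s $$ (t, b) = of_bool (Suc u = b) - of_bool (u = b)"
    if t: "t \<in> {q..Suc (q + k)}" for t
  proof -
    \<comment> \<open>\<open>r s\<close> is the transposition of the coordinates
      \<open>s - 1\<close> and \<open>s\<close>.\<close>
    let ?u = "if t = s then s - 1 else if Suc t = s then s else t"
    have "\<forall>b\<in>K. r s $$ (Suc t, b) - r s $$ (t, b) = of_bool (Suc ?u = b) - of_bool (?u = b)"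
      using t s occ_simps(2) by (auto simp: e red_gram_K)
    moreover have "?u \<in> {q..Suc (q + k)}" using t s by auto
    ultimately show ?thesis by blast
  qed
  then show ?thesis
    using s sn occ_simps(2) by (auto simp: permutes_coords_def r_carrier e)
qed

lemma permutes_coords_mult:
  assumes x: "permutes_coords x" and y: "permutes_coords y"
  shows "permutes_coords (x * y)"
proof -
  have c: "x \<in> carrier_mat n n" "y \<in> carrier_mat n n" and
    x0: "\<And>a b. b \<in> K \<Longrightarrow> a < n \<Longrightarrow> a \<notin> K \<Longrightarrow> x $$ (a, b) = 0" and
    y0: "\<And>a b. b \<in> K \<Longrightarrow> a < n \<Longrightarrow> a \<notin> K \<Longrightarrow> y $$ (a, b) = 0"
    using x y by (auto simp: permutes_coords_def)
  have Kn: "K \<subseteq> {..<n}" using occ_simps(2) by auto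
  have e: "(x * y) $$ (a, b) = (\<Sum>c\<in>K. x $$ (a, c) * y $$ (c, b))" if "a < n" "b \<in> K" for a b
  proof -
    have "(x * y) $$ (a, b) = (\<Sum>c<n. x $$ (a, c) * y $$ (c, b))"
      using c that Kn by (auto simp: scalar_prod_def lessThan_atLeast0 intro!: sum.cong)
    also have "\<dots> = (\<Sum>c\<in>K. x $$ (a, c) * y $$ (c, b))"
      using Kn that y0 by (intro sum.mono_neutral_right) auto
    finally show ?thesis .
  qed
  have "\<exists>u\<in>{q..Suc (q + k)}. \<forall>b\<in>K.
         (x * y) $$ (Suc t, b) - (x * y) $$ (t, b) = of_bool (Suc u = b) - of_bool (u = b)"
    if t: "t \<in> {q..Suc (q + k)}" for t
  proof -
    obtain u where u: "u \<in> {q..Suc (q + k)}" and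
      xu: "\<And>b. b \<in> K \<Longrightarrow> x $$ (Suc t, b) - x $$ (t, b) = of_bool (Suc u = b) - of_bool (u = b)"
      using x t unfolding permutes_coords_def by meson
    obtain w where w: "w \<in> {q..Suc (q + k)}" and
      yw: "\<And>b. b \<in> K \<Longrightarrow> y $$ (Suc u, b) - y $$ (u, b) = of_bool (Suc w = b) - of_bool (w = b)"
      using y u unfolding permutes_coords_def by meson
    have un: "u < n" "Suc u < n" using u occ_simps(2) by auto
    have "(x * y) $$ (Suc t, b) - (x * y) $$ (t, b) = of_bool (Suc w = b) - of_bool (w = b)"
      if b: "b \<in> K" for b
    proof -
      \<comment> \<open>At the extremes \<open>u = q\<close> and \<open>u = Suc (q + k)\<close>, one
        of \<open>u\<close>, \<open>Suc u\<close> lies outside \<open>K\<close>, where the entries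
        of \<open>y\<close> vanish.\<close>
      have yK: "(if a \<in> K then y $$ (a, b) else 0) = y $$ (a, b)" if "a < n" for a
        using y0[OF b that] by (cases "a \<in> K") (simp_all del: atLeastAtMost_iff)
      have "(x * y) $$ (Suc t, b) - (x * y) $$ (t, b)
        = (\<Sum>c\<in>K. (x $$ (Suc t, c) - x $$ (t, c)) * y $$ (c, b))"
        using t b occ_simps(2) by (simp add: e sum_subtractf algebra_simps)
      also have "\<dots> = (\<Sum>c\<in>K. (if c = Suc u then y $$ (c, b) else 0) - (if c = u then y $$ (c, b) else 0))"
        by (intro sum.cong refl) (auto simp: xu)
      also have "\<dots> = (if Suc u \<in> K then y $$ (Suc u, b) else 0) - (if u \<in> K then y $$ (u, b) else 0)"
        unfolding sum_subtractf sum.delta[OF finite_atLeastAtMost] by (rule refl)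
      also have "\<dots> = y $$ (Suc u, b) - y $$ (u, b)"
        by (simp only: yK un)
      finally show ?thesis using yw[OF b] by simp
    qed
    with w show ?thesis by blast
  qed
  moreover have "(x * y) $$ (a, b) = 0" if "b \<in> K" "a < n" "a \<notin> K" for a b
    using that by (simp add: e x0)
  ultimately show ?thesis using c by (auto simp: permutes_coords_def)
qed

lemma permutes_coords_generate:
  assumes "x \<in> generate H (r ` K)"
  shows "permutes_coords x"
proof -
  have "K \<subseteq> {..<n}" using occ_simps(2) by auto
  with assms show ?thesis
  proof (induction rule: generate_H_induct)
    case one
    then show ?case
      using occ_simps(2) by (auto simp: permutes_coords_def intro!: bexI)
  qed (auto intro: permutes_coords_r permutes_coords_mult)
qed

text \<open>For \<open>k = 1\<close> the third vector is the right end node, outside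
  \<open>K\<close>; hence the later condition on \<gamma>.\<close>

definition comb :: "'p mod_ring \<Rightarrow> 'p mod_ring \<Rightarrow> 'p mod_ring \<Rightarrow> nat \<Rightarrow> 'p mod_ring" where
  "comb \<alpha> \<beta> \<gamma> t = \<alpha> * basis (Suc q) t + \<beta> * basis (Suc (Suc q)) t + \<gamma> * basis (Suc (Suc (Suc q))) t"

text \<open>The reflection must turn the coordinate \<open>q\<close> into some coordinate
  \<open>u\<close>. The left pair holds the values of the new functional at the first two nodes of
  \<open>K\<close>; the four listed pairs belong to \<open>u = q\<close>, \<open>Suc q\<close>,
  \<open>Suc (Suc q)\<close> and any other \<open>u\<close>.\<close>

lemma comb_not_in_K:
  assumes mem: "refl_matrix (comb \<alpha> \<beta> \<gamma>) \<in> generate H (r ` K)" and \<gamma>: "\<gamma> \<noteq> 0 \<Longrightarrow> 2 \<le> k"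
  shows "(1 - \<alpha> * (2 * \<alpha> - \<beta>), - \<alpha> * (2 * \<beta> - \<alpha> - \<gamma>)) \<in> {(1, 0), (- 1, 1), (0, - 1), (0, 0)}"
proof -
  let ?x = "refl_matrix (comb \<alpha> \<beta> \<gamma>)"
  have "q \<in> {q..Suc (q + k)}" by simp
  then obtain u where u:
    "\<And>b. b \<in> K \<Longrightarrow> ?x $$ (Suc q, b) - ?x $$ (q, b) = of_bool (Suc u = b) - of_bool (u = b)"
    using permutes_coords_generate[OF mem] unfolding permutes_coords_def by meson
  have comb: "comb \<alpha> \<beta> \<gamma> = (\<lambda>t. \<alpha> * basis (Suc q) t + \<beta> * basis (Suc (Suc q)) t
      + \<gamma> * basis (Suc (Suc (Suc q))) t)"
    by (auto simp: comb_def)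
  have g3: "\<gamma> * pair (basis (Suc (Suc (Suc q)))) (basis b) = \<gamma> * (- of_bool (b = Suc (Suc q)))"
    if "b \<in> {Suc q, Suc (Suc q)}" for b
  proof (cases "\<gamma> = 0")
    case False
    then have "Suc (Suc (Suc q)) \<in> K" using \<gamma> by simp
    moreover have "b \<in> K" using that occ_simps(1) by auto
    ultimately show ?thesis using that occ_simps(2) by (auto simp: pair_basis red_gram_K)
  qed simp
  have p: "pair (comb \<alpha> \<beta> \<gamma>) (basis (Suc q)) = 2 * \<alpha> - \<beta>"
    "pair (comb \<alpha> \<beta> \<gamma>) (basis (Suc (Suc q))) = 2 * \<beta> - \<alpha> - \<gamma>"
    using occ_simps(1,2)
    unfolding comb pair_linear g3[OF insertI1] g3[OF insertI2[OF singletonI]]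
    by (simp_all add: pair_basis red_gram_K)
  have "?x $$ (Suc q, b) - ?x $$ (q, b) = of_bool (b = Suc q) - \<alpha> * pair (comb \<alpha> \<beta> \<gamma>) (basis b)"
    if "b \<in> {Suc q, Suc (Suc q)}" for b
    using that occ_simps(2) by (auto simp: refl_matrix_def) (auto simp: comb_def basis_def)
  then have "1 - \<alpha> * (2 * \<alpha> - \<beta>) = of_bool (Suc u = Suc q) - of_bool (u = Suc q)"
    "- \<alpha> * (2 * \<beta> - \<alpha> - \<gamma>) = of_bool (Suc u = Suc (Suc q)) - of_bool (u = Suc (Suc q))"
    using u[of "Suc q"] u[of "Suc (Suc q)"] occ_simps(1) by (simp_all add: p)
  then show ?thesis by (auto simp: of_bool_def split: if_splits)
qed

section \<open>Choice of the new vector for each prime\<close>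

lemma generic_new_root:
  fixes R :: "(nat \<Rightarrow> 'p mod_ring) set"
  assumes "refl_closed R" "u0 \<in> R" "u1 \<in> R" "u2 \<in> R"
    "pair u0 u1 = - 2" "pair u0 u2 = 0" "pair u1 u2 = - 1" and nz: "(7 :: 'p mod_ring) \<noteq> 0"
  shows "(\<lambda>t. 8 / 7 * u1 t + 5 / 7 * u2 t) \<in> R"
proof -
  \<comment> \<open>Every element of a prime field is a natural number multiple of 1, so
    translations reach the coefficient \<open>- 1 / 7\<close>.\<close>
  obtain N where "(- 1 / 7 :: 'p mod_ring) = of_nat N" using surj_of_nat_mod_ring by blast
  then have "7 * of_nat N = (- 1 :: 'p mod_ring)"
    using nz by (metis nonzero_mult_div_cancel_left times_divide_eq_right)
  then show ?thesis using assms by (intro new_root_rank3) auto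
qed

text \<open>The coefficients are fixed before \<open>R\<close> and \<open>u\<close>, so the left and
  the right end produce the same vector.\<close>

lemma ex_new_root:
  assumes p: "CARD('p) \<ge> 5" "CARD('p) = 5 \<or> CARD('p) = 7 \<Longrightarrow> 2 \<le> k"
  obtains \<alpha> \<beta> \<gamma> :: "'p mod_ring" where "\<gamma> \<noteq> 0 \<Longrightarrow> 2 \<le> k"
    "(1 - \<alpha> * (2 * \<alpha> - \<beta>), - \<alpha> * (2 * \<beta> - \<alpha> - \<gamma>)) \<notin> {(1, 0), (- 1, 1), (0, - 1), (0, 0)}"
    "\<And>R u. refl_closed R \<Longrightarrow> u \<in> R \<Longrightarrow> (\<And>b. b \<in> K \<Longrightarrow> basis b \<in> R)
      \<Longrightarrow> (\<And>b. b \<in> K \<Longrightarrow> pair u (basis b) = - 2 * of_bool (b = Suc q)) \<Longrightarrow> comb \<alpha> \<beta> \<gamma> \<in> R"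
proof -
  have nz: "(of_nat l :: 'p mod_ring) \<noteq> 0" if "prime l" "l \<noteq> CARD('p)" for l
    using that of_nat_0_mod_ring_dvd[of l, where 'a = 'p] prime_card[where 'a = 'p]
    by (metis primes_dvd_imp_eq)
  have nz2: "(2 :: 'p mod_ring) \<noteq> 0" and nz3: "(3 :: 'p mod_ring) \<noteq> 0"
    using nz[of 2] nz[of 3] p(1) by simp_all
  have pK: "pair (basis a) (basis b) = 2 * of_bool (a = b) - of_bool (a = Suc b) - of_bool (b = Suc a)"
    if "a \<in> K" "b \<in> K" for a b
    using that occ_simps(2) by (simp add: pair_basis red_gram_K)
  consider "CARD('p) \<noteq> 5" "CARD('p) \<noteq> 7" | "CARD('p) = 5 \<or> CARD('p) = 7" by blast
  then show ?thesis
  proof cases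
    case 1
    have "prime (5::nat)" "prime (7::nat)" by simp_all
    then have nz5: "(5 :: 'p mod_ring) \<noteq> 0" and nz7: "(7 :: 'p mod_ring) \<noteq> 0"
      using nz[of 5] nz[of 7] 1 by simp_all
    show ?thesis
    \<comment> \<open>The instantiation order is \<gamma>, \<alpha>, \<beta>.\<close>
    proof (rule that[of 0 "8 / 7" "5 / 7"])
      define A C :: "'p mod_ring" where "A = 1 - 8 / 7 * (2 * (8 / 7) - 5 / 7)"
        and "C = - (8 / 7) * (2 * (5 / 7) - 8 / 7 - 0)"
      have "(7 :: 'p mod_ring) ^ 3 \<noteq> 0" using nz7 by (rule power_not_zero)
      then have nz343: "(343 :: 'p mod_ring) \<noteq> 0" by simp
      \<comment> \<open>With denominators cleared, second entry 0 forces 16 = 0, the pair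
        \<open>(- 1, 1)\<close> forces 10 = 0, and \<open>(0, - 1)\<close> forces 6 = 0.\<close>
      have A: "49 * A = - 39" and C: "49 * C = - 16"
        using nz7 nz343 by (simp_all add: A_def C_def field_simps)
      have "C \<noteq> 0"
      proof
        assume "C = 0"
        then have "(2 :: 'p mod_ring) ^ 4 = 0" using C by simp
        then show False using power_not_zero[OF nz2, of 4] by blast
      qed
      moreover have "\<not> (A = - 1 \<and> C = 1)"
      proof
        assume "A = - 1 \<and> C = 1"
        then have "(2 * 5 :: 'p mod_ring) = 0" using A by (simp add: neg_eq_iff_add_eq_0)
        then show False using nz2 nz5 by (metis mult_eq_0_iff)
      qed
      moreover have "\<not> (A = 0 \<and> C = - 1)"
      proof
        assume "A = 0 \<and> C = - 1"
        then have "(39 :: 'p mod_ring) = 0" "(49 :: 'p mod_ring) = 16" using A C by simp_all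
        moreover have "(2 * 3 :: 'p mod_ring) = 39 - (49 - 16)" by simp
        ultimately have "(2 * 3 :: 'p mod_ring) = 0" by simp
        then show False using nz2 nz3 by (metis mult_eq_0_iff)
      qed
      ultimately show "(1 - 8 / 7 * (2 * (8 / 7) - 5 / 7), - (8 / 7) * (2 * (5 / 7) - 8 / 7 - 0))
        \<notin> {(1, 0), (- 1, 1), (0, - 1), (0 :: 'p mod_ring, 0 :: 'p mod_ring)}"
        unfolding A_def[symmetric] C_def[symmetric] by auto
    next
      fix R u
      assume R: "refl_closed R" "u \<in> R" "\<And>b. b \<in> K \<Longrightarrow> basis b \<in> R"
        "\<And>b. b \<in> K \<Longrightarrow> pair u (basis b) = - 2 * of_bool (b = Suc q)"
      have "(\<lambda>t. 8 / 7 * basis (Suc q) t + 5 / 7 * basis (Suc (Suc q)) t) \<in> R"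
        using R occ_simps(1) by (intro generic_new_root[of R u]) (simp_all add: pK nz7)
      then show "comb (8 / 7) (5 / 7) 0 \<in> R" by (simp add: comb_def[abs_def])
    qed simp
  next
    case 2
    then have k: "2 \<le> k" using p by blast
    define c where "c u l = (if l = 0 then u else basis (q + l))" for u and l :: nat
    have roots: "lin4 (c u) 140 96 27 24 \<in> R" "lin4 (c u) 98 67 19 16 \<in> R"
      if "refl_closed R" "u \<in> R" "\<And>b. b \<in> K \<Longrightarrow> basis b \<in> R"
        "\<And>b. b \<in> K \<Longrightarrow> pair u (basis b) = - 2 * of_bool (b = Suc q)" for R u
      using that k new_roots_rank4[of R "c u"] by (simp_all add: c_def pK)
    from 2 show ?thesis
    proof
      assume "CARD('p) = 5"
      then have z: "(5 :: 'p mod_ring) = 0"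
        using of_nat_card_eq_0[where 'a = 'p] by simp
      \<comment> \<open>Splitting off multiples of 5 lets \<open>z\<close> reduce the numerals; the
        pair to be excluded becomes \<open>(1, 1)\<close>.\<close>
      have e: "(140 :: 'p mod_ring) = 5 * 28" "(96 :: 'p mod_ring) = 5 * 19 + 1"
        "(27 :: 'p mod_ring) = 5 * 5 + 2" "(24 :: 'p mod_ring) = 5 * 5 - 1"
        "(4 :: 'p mod_ring) = 5 - 1"
        by simp_all
      show ?thesis
      proof (rule that[of "- 1" 1 2])
        show "comb 1 2 (- 1) \<in> R" if "refl_closed R" "u \<in> R" "\<And>b. b \<in> K \<Longrightarrow> basis b \<in> R"
          "\<And>b. b \<in> K \<Longrightarrow> pair u (basis b) = - 2 * of_bool (b = Suc q)" for R u
        proof -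
          have "lin4 (c u) 140 96 27 24 = comb 1 2 (- 1)"
            by (rule ext)
              (simp only: lin4_def comb_def of_int_numeral e z, simp add: c_def numeral_2_eq_2 numeral_3_eq_3)
          then show ?thesis using roots(1)[OF that] by simp
        qed
        have "(1 :: 'p mod_ring) + 1 \<noteq> 0" using nz2 by simp
        then have "(1 :: 'p mod_ring) \<noteq> - 1" by (metis add.right_inverse)
        then show "(1 - 1 * (2 * 1 - 2), - 1 * (2 * 2 - 1 - - 1))
          \<notin> {(1, 0), (- 1, 1), (0, - 1), (0 :: 'p mod_ring, 0 :: 'p mod_ring)}"
          by (simp add: e z)
      qed (use k in simp)
    next
      assume "CARD('p) = 7"
      then have z: "(7 :: 'p mod_ring) = 0"
        using of_nat_card_eq_0[where 'a = 'p] by simp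
      have e: "(98 :: 'p mod_ring) = 7 * 14" "(67 :: 'p mod_ring) = 7 * 9 + 4"
        "(19 :: 'p mod_ring) = 7 * 3 - 2" "(16 :: 'p mod_ring) = 7 * 2 + 2"
        by simp_all
      show ?thesis
      proof (rule that[of 2 4 "- 2"])
        show "comb 4 (- 2) 2 \<in> R" if "refl_closed R" "u \<in> R" "\<And>b. b \<in> K \<Longrightarrow> basis b \<in> R"
          "\<And>b. b \<in> K \<Longrightarrow> pair u (basis b) = - 2 * of_bool (b = Suc q)" for R u
        proof -
          have "lin4 (c u) 98 67 19 16 = comb 4 (- 2) 2"
            by (rule ext)
              (simp only: lin4_def comb_def of_int_numeral e z, simp add: c_def numeral_2_eq_2 numeral_3_eq_3)
          then show ?thesis using roots(2)[OF that] by simp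
        qed
        \<comment> \<open>Mod 7 the first entry is 3, which differs from 1, -1 and 0 and so rules
          out all four pairs.\<close>
        have A: "1 - 4 * (2 * 4 - - 2) = (3 :: 'p mod_ring) - 7 * 6" by simp
        have "(2 * 2 :: 'p mod_ring) \<noteq> 0" using nz2 by (metis mult_eq_0_iff)
        then have "(3 :: 'p mod_ring) \<noteq> - 1" by (simp add: eq_neg_iff_add_eq_0)
        moreover have "(3 :: 'p mod_ring) \<noteq> 1"
        proof
          assume "(3 :: 'p mod_ring) = 1"
          then have "(3 :: 'p mod_ring) - 1 = 0" by simp
          then show False using nz2 by simp
        qed
        ultimately show "(1 - 4 * (2 * 4 - - 2), - 4 * (2 * - 2 - 4 - 2))
          \<notin> {(1, 0), (- 1, 1), (0, - 1), (0 :: 'p mod_ring, 0 :: 'p mod_ring)}"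
          unfolding A z using nz3 by simp
      qed (use k in simp)
    qed
  qed
qed

section \<open>Failure of the intersection property\<close>

lemma not_string_C_group_if_occurs:
  assumes "CARD('p) \<ge> 5" "CARD('p) = 5 \<or> CARD('p) = 7 \<Longrightarrow> 2 \<le> k"
  shows "\<not> string_C_group H n r"
proof
  assume C: "string_C_group H n r"
  let ?I = "{q..Suc (q + k)}" and ?J = "{Suc q..Suc (Suc (q + k))}"
  obtain \<alpha> \<beta> \<gamma> :: "'p mod_ring" where c: "\<gamma> \<noteq> 0 \<Longrightarrow> 2 \<le> k"
    "(1 - \<alpha> * (2 * \<alpha> - \<beta>), - \<alpha> * (2 * \<beta> - \<alpha> - \<gamma>)) \<notin> {(1, 0), (- 1, 1), (0, - 1), (0, 0)}"
    "\<And>R u. refl_closed R \<Longrightarrow> u \<in> R \<Longrightarrow> (\<And>b. b \<in> K \<Longrightarrow> basis b \<in> R)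
      \<Longrightarrow> (\<And>b. b \<in> K \<Longrightarrow> pair u (basis b) = - 2 * of_bool (b = Suc q)) \<Longrightarrow> comb \<alpha> \<beta> \<gamma> \<in> R"
    using ex_new_root[OF assms] by metis
  have "comb \<alpha> \<beta> \<gamma> \<in> root_set ?I"
  proof (rule c(3)[OF refl_closed_root_set])
    show "pair (basis q) (basis b) = - 2 * of_bool (b = Suc q)" if "b \<in> K" for b
      using that occ_simps(2,3) by (cases "b = Suc q") (simp_all add: pair_basis red_gram_simps)
  qed (use occ_simps(2) in \<open>auto intro: root_set_basis\<close>)
  moreover obtain u where u: "u \<in> root_set ?J"
    "\<And>b. b \<in> K \<Longrightarrow> pair u (basis b) = - 2 * of_bool (b = Suc q)"
    using end_root by blast
  have "comb \<alpha> \<beta> \<gamma> \<in> root_set ?J"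
    by (rule c(3)[OF refl_closed_root_set u(1) _ u(2)])
      (use occ_simps(2) in \<open>auto intro: root_set_basis\<close>)
  ultimately have "refl_matrix (comb \<alpha> \<beta> \<gamma>) \<in> generate H (r ` ?I) \<inter> generate H (r ` ?J)"
    by (simp add: root_set_def)
  also have "generate H (r ` ?I) \<inter> generate H (r ` ?J) = generate H (r ` (?I \<inter> ?J))"
    using C occ_simps(2) unfolding string_C_group_def by (simp add: subset_iff)
  also have "?I \<inter> ?J = K" by auto
  finally show False using comb_not_in_K c(1,2) by blast
qed

end

end

theorem theorem3p5:
  fixes n :: nat and m :: "nat \<Rightarrow> enat"
  assumes "string_symbol n m"
    and "\<exists>i k. occurs_inf_3k_inf n m i k"
    and "CARD('p::prime_card) \<ge> 5"
    and "\<not> ((CARD('p) = 5 \<or> CARD('p) = 7) \<and> (\<forall>i k. occurs_inf_3k_inf n m i k \<longrightarrow> k \<le> 1))"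
  shows "\<not> string_C_group (red_group n m :: 'p mod_ring mat monoid) n (red_refl n m)"
proof -
  interpret string_mod n m "TYPE('p)" by unfold_locales (rule assms(1))
  \<comment> \<open>For \<open>p = 5\<close> or \<open>p = 7\<close> the last assumption supplies an
    occurrence with \<open>k \<ge> 2\<close>; otherwise any occurrence will do.\<close>
  obtain i k where ik: "occurs_inf_3k_inf n m i k"
    "CARD('p) = 5 \<or> CARD('p) = 7 \<Longrightarrow> 2 \<le> k"
    using assms(2,4) by (metis Suc_1 not_less_eq_eq)
  moreover from this obtain q where "i = Suc q"
    by (cases i) (auto simp: occurs_inf_3k_inf_def)
  ultimately show ?thesis
    using not_string_C_group_if_occurs[of q k] assms(3) by blast
qed

end
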